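(* Let $A\in\mathbb{R}^{n\times n}$ and let $u,v\in\mathbb{R}^n$ be such that $uv^T>0$ entrywise. Then $$r(A,uv^T)=r(D_u^{-1}AD_v^{-1}).$$
   Context: $D_w$ denotes the diagonal matrix with diagonal $w$. For $A\in\mathbb{R}^{n\times n}$ and an entrywise nonnegative $\Delta\in\mathbb{R}^{n\times n}$, the regularity radius is $r(A,\Delta)=\min\{\delta\ge 0 : [A-\delta\Delta,A+\delta\Delta]\text{ is singular}\}$, where $[A-\delta\Delta,A+\delta\Delta]$ is the set of all real matrices $A'$ with $A-\delta\Delta\le A'\le A+\delta\Delta$ entrywise, and this set is called singular if it contains at least one singular matrix. Moreover $r(A):=r(A,ee^T)$, where $e=(1,\dots,1)^T$. *)

theory Defs
  imports "HOL-Analysis.Analysis"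
begin

definition diag_mat :: "real^'n \<Rightarrow> real^'n^'n" where
  "diag_mat w = (\<chi> i j. if i = j then w $ i else 0)"

definition outer_prod :: "real^'n \<Rightarrow> real^'n \<Rightarrow> real^'n^'n" where
  "outer_prod u v = (\<chi> i j. u $ i * v $ j)"

definition ones :: "real^'n" where
  "ones = (\<chi> i. 1)"

(* The order on real^'n^'n is the entrywise one, so {L..U} below is an interval matrix. *)
definition singular_set :: "(real^'n^'n) set \<Rightarrow> bool" where
  "singular_set S \<longleftrightarrow> (\<exists>A'\<in>S. \<not> invertible A')"

(* The minimum exists as soon as some delta >= 0 gives a singular interval matrix
   (regularity_radius_attained), in particular whenever Delta > 0 entrywise
   (regularity_radius_attained_pos); otherwise the value is unspecified. *)
definition regularity_radius :: "real^'n^'n \<Rightarrow> real^'n^'n \<Rightarrow> real" where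
  "regularity_radius A \<Delta> =
     (LEAST \<delta>. 0 \<le> \<delta> \<and> singular_set {A - \<delta> *\<^sub>R \<Delta> .. A + \<delta> *\<^sub>R \<Delta>})"

definition regularity_radius_unit :: "real^'n^'n \<Rightarrow> real" where
  "regularity_radius_unit A = regularity_radius A (outer_prod ones ones)"

lemma singular_radii_have_min:
  fixes A \<Delta> :: "real^'n^'n"
  assumes nonneg: "\<And>i j. 0 \<le> \<Delta> $ i $ j"
    and ex: "0 \<le> \<delta>0" "singular_set {A - \<delta>0 *\<^sub>R \<Delta> .. A + \<delta>0 *\<^sub>R \<Delta>}"
  shows "\<exists>\<delta>. (0 \<le> \<delta> \<and> singular_set {A - \<delta> *\<^sub>R \<Delta> .. A + \<delta> *\<^sub>R \<Delta>}) \<and>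
           (\<forall>\<epsilon>. 0 \<le> \<epsilon> \<and> singular_set {A - \<epsilon> *\<^sub>R \<Delta> .. A + \<epsilon> *\<^sub>R \<Delta>} \<longrightarrow> \<delta> \<le> \<epsilon>)"
proof -
  define T where "T = ({0..\<delta>0} \<times> {A - \<delta>0 *\<^sub>R \<Delta> .. A + \<delta>0 *\<^sub>R \<Delta>}) \<inter>
     {p. A - fst p *\<^sub>R \<Delta> \<le> snd p \<and> snd p \<le> A + fst p *\<^sub>R \<Delta> \<and> det (snd p) = 0}"
  have "closed {p :: real \<times> (real^'n^'n). A - fst p *\<^sub>R \<Delta> \<le> snd p \<and>
      snd p \<le> A + fst p *\<^sub>R \<Delta> \<and> det (snd p) = 0}"
    unfolding det_def less_eq_vec_def
    by (intro closed_Collect_conj closed_Collect_all closed_Collect_le closed_Collect_eq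
        continuous_intros)
  moreover have "compact ({0..\<delta>0} \<times> {A - \<delta>0 *\<^sub>R \<Delta> .. A + \<delta>0 *\<^sub>R \<Delta>})"
    by (intro compact_Times compact_Icc) (metis cbox_interval compact_cbox)
  ultimately have "compact T"
    unfolding T_def by (rule compact_Int_closed[rotated])
  moreover have "T \<noteq> {}"
  proof -
    obtain B where "B \<in> {A - \<delta>0 *\<^sub>R \<Delta> .. A + \<delta>0 *\<^sub>R \<Delta>}" "det B = 0"
      using ex(2) unfolding singular_set_def invertible_det_nz by blast
    then have "(\<delta>0, B) \<in> T"
      using ex(1) by (simp add: T_def)
    then show ?thesis by blast
  qed
  moreover have "continuous_on T fst"
    by (intro continuous_intros)
  ultimately have "\<exists>p\<in>T. \<forall>q\<in>T. fst p \<le> fst q"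
    by (rule continuous_attains_inf)
  then obtain p where p: "p \<in> T" "\<And>q. q \<in> T \<Longrightarrow> fst p \<le> fst q"
    by (elim bexE) simp
  have "fst p \<le> \<epsilon>"
    if \<epsilon>: "0 \<le> \<epsilon>" "singular_set {A - \<epsilon> *\<^sub>R \<Delta> .. A + \<epsilon> *\<^sub>R \<Delta>}" for \<epsilon>
  proof (cases "\<epsilon> \<le> \<delta>0")
    case True
    obtain B where B: "A - \<epsilon> *\<^sub>R \<Delta> \<le> B" "B \<le> A + \<epsilon> *\<^sub>R \<Delta>" "det B = 0"
      using \<epsilon> by (auto simp: singular_set_def invertible_det_nz)
    have le: "\<epsilon> *\<^sub>R \<Delta> \<le> \<delta>0 *\<^sub>R \<Delta>"
      using True nonneg by (simp add: less_eq_vec_def mult_right_mono)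
    have "A - \<delta>0 *\<^sub>R \<Delta> \<le> B" "B \<le> A + \<delta>0 *\<^sub>R \<Delta>"
      using B(1,2) le by (auto intro: order.trans[OF diff_left_mono] order.trans[OF _ add_left_mono])
    then have "(\<epsilon>, B) \<in> T"
      using B \<epsilon> True by (simp add: T_def)
    from p(2)[OF this] show ?thesis by simp
  next
    case False
    have "fst p \<le> \<delta>0" using p(1) by (auto simp: T_def)
    with False show ?thesis by simp
  qed
  moreover have "0 \<le> fst p" "singular_set {A - fst p *\<^sub>R \<Delta> .. A + fst p *\<^sub>R \<Delta>}"
    using p(1) by (auto simp: T_def singular_set_def invertible_det_nz)
  ultimately show ?thesis by blast
qed

lemma regularity_radius_attained:
  fixes A \<Delta> :: "real^'n^'n"
  assumes "\<And>i j. 0 \<le> \<Delta> $ i $ j"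
    and "0 \<le> \<delta>0" "singular_set {A - \<delta>0 *\<^sub>R \<Delta> .. A + \<delta>0 *\<^sub>R \<Delta>}"
  defines "r \<equiv> regularity_radius A \<Delta>"
  shows "0 \<le> r" "singular_set {A - r *\<^sub>R \<Delta> .. A + r *\<^sub>R \<Delta>}"
    and "\<And>\<epsilon>. 0 \<le> \<epsilon> \<Longrightarrow> singular_set {A - \<epsilon> *\<^sub>R \<Delta> .. A + \<epsilon> *\<^sub>R \<Delta>} \<Longrightarrow> r \<le> \<epsilon>"
proof -
  obtain d where d: "0 \<le> d \<and> singular_set {A - d *\<^sub>R \<Delta> .. A + d *\<^sub>R \<Delta>}"
    and min: "\<forall>\<epsilon>. 0 \<le> \<epsilon> \<and> singular_set {A - \<epsilon> *\<^sub>R \<Delta> .. A + \<epsilon> *\<^sub>R \<Delta>} \<longrightarrow> d \<le> \<epsilon>"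
    using singular_radii_have_min[OF assms(1-3)] by blast
  have "r = d"
    unfolding r_def regularity_radius_def
    by (rule Least_equality) (use d min in auto)
  with d min show "0 \<le> r" "singular_set {A - r *\<^sub>R \<Delta> .. A + r *\<^sub>R \<Delta>}"
    "\<And>\<epsilon>. 0 \<le> \<epsilon> \<Longrightarrow> singular_set {A - \<epsilon> *\<^sub>R \<Delta> .. A + \<epsilon> *\<^sub>R \<Delta>} \<Longrightarrow> r \<le> \<epsilon>"
    by auto
qed

lemma regularity_radius_attained_pos:
  fixes A \<Delta> :: "real^'n^'n"
  assumes pos: "\<And>i j. 0 < \<Delta> $ i $ j"
  defines "r \<equiv> regularity_radius A \<Delta>"
  shows "0 \<le> r" "singular_set {A - r *\<^sub>R \<Delta> .. A + r *\<^sub>R \<Delta>}"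
    and "\<And>\<epsilon>. 0 \<le> \<epsilon> \<Longrightarrow> singular_set {A - \<epsilon> *\<^sub>R \<Delta> .. A + \<epsilon> *\<^sub>R \<Delta>} \<Longrightarrow> r \<le> \<epsilon>"
proof -
  define d where "d = (\<Sum>i\<in>UNIV. \<Sum>j\<in>UNIV. \<bar>A $ i $ j\<bar> / \<Delta> $ i $ j)"
  have q: "0 \<le> \<bar>A $ i $ j\<bar> / \<Delta> $ i $ j" for i j
    using pos[of i j] by simp
  then have d0: "0 \<le> d"
    unfolding d_def by (intro sum_nonneg) auto
  have "\<bar>A $ i $ j\<bar> \<le> d * \<Delta> $ i $ j" for i j
  proof -
    have "\<bar>A $ i $ j\<bar> / \<Delta> $ i $ j \<le> (\<Sum>j\<in>UNIV. \<bar>A $ i $ j\<bar> / \<Delta> $ i $ j)"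
      by (rule member_le_sum) (use q in auto)
    also have "\<dots> \<le> d"
      unfolding d_def by (rule member_le_sum) (use q in \<open>auto intro: sum_nonneg\<close>)
    finally show ?thesis
      using pos[of i j] by (simp add: divide_le_eq)
  qed
  then have "A $ i $ j \<le> d * \<Delta> $ i $ j" "0 \<le> A $ i $ j + d * \<Delta> $ i $ j" for i j
    using abs_ge_self[of "A $ i $ j"] abs_ge_minus_self[of "A $ i $ j"]
    by (meson order_trans, smt (verit))
  then have "0 \<in> {A - d *\<^sub>R \<Delta> .. A + d *\<^sub>R \<Delta>}"
    by (simp add: less_eq_vec_def)
  moreover have "\<not> invertible (0 :: real^'n^'n)"
    by (metis det_0 invertible_det_nz mat_0)
  ultimately have "singular_set {A - d *\<^sub>R \<Delta> .. A + d *\<^sub>R \<Delta>}"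
    unfolding singular_set_def by blast
  from regularity_radius_attained[OF less_imp_le[OF pos] d0 this]
  show "0 \<le> r" "singular_set {A - r *\<^sub>R \<Delta> .. A + r *\<^sub>R \<Delta>}"
    "\<And>\<epsilon>. 0 \<le> \<epsilon> \<Longrightarrow> singular_set {A - \<epsilon> *\<^sub>R \<Delta> .. A + \<epsilon> *\<^sub>R \<Delta>} \<Longrightarrow> r \<le> \<epsilon>"
    unfolding r_def by auto
qed

end

theory Submission
  imports Defs
begin

text \<open>Left and right multiplication by \<open>D\<^sub>a\<close> and \<open>D\<^sub>b\<close> with \<open>ab\<^sup>T > 0\<close> is monotone in the
  entrywise order and preserves singularity. Hence \<open>D\<^sub>u\<^sup>-\<^sup>1 \<cdot> D\<^sub>v\<^sup>-\<^sup>1\<close>, whose inverse is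
  again of this form, identifies \<open>[A - \<delta>uv\<^sup>T, A + \<delta>uv\<^sup>T]\<close> with the interval of radius \<open>\<delta>ee\<^sup>T\<close>
  around \<open>D\<^sub>u\<^sup>-\<^sup>1AD\<^sub>v\<^sup>-\<^sup>1\<close>, for every \<open>\<delta>\<close>.\<close>

lemma diag_mat_scale_nth:
  fixes X :: "real^'n^'n"
  shows "(diag_mat a ** X ** diag_mat b) $ i $ j = a $ i * X $ i $ j * b $ j"
proof -
  have "(\<Sum>k\<in>UNIV. (diag_mat a ** X) $ i $ k * diag_mat b $ k $ j) = (diag_mat a ** X) $ i $ j * b $ j"
    by (simp add: diag_mat_def if_distrib[of "\<lambda>t. _ * t"] cong: if_cong)
  moreover have "(diag_mat a ** X) $ i $ j = a $ i * X $ i $ j"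
    by (simp add: diag_mat_def matrix_matrix_mult_def if_distrib[of "\<lambda>t. t * _"] cong: if_cong)
  ultimately show ?thesis
    by (simp add: matrix_matrix_mult_def)
qed

lemma diag_mat_mult: "diag_mat a ** diag_mat b = diag_mat (\<chi> i. a $ i * b $ i)"
proof -
  \<comment> \<open>The identity inserted as middle factor reduces the product to the scaling
    formula.\<close>
  have "(diag_mat a ** diag_mat b) $ i $ j = a $ i * mat 1 $ i $ j * b $ j" for i j
    using diag_mat_scale_nth[of a "mat 1" b i j] by simp
  then show ?thesis
    by (simp add: vec_eq_iff diag_mat_def mat_def)
qed

lemma matrix_inv_diag_mat:
  assumes "\<And>i. w $ i \<noteq> 0"
  shows "matrix_inv (diag_mat w) = diag_mat (\<chi> i. inverse (w $ i))"
proof -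
  have inv: "diag_mat w ** diag_mat (\<chi> i. inverse (w $ i)) = mat 1"
    using assms by (simp add: diag_mat_mult vec_eq_iff) (simp add: diag_mat_def mat_def)
  then have "invertible (diag_mat w)"
    using invertible_right_inverse by blast
  \<comment> \<open>\<open>matrix_inv\<close> is a choice of a two-sided inverse; its left-inverse
    property and the explicit right inverse \<open>inv\<close> force the two to coincide.\<close>
  then have "matrix_inv (diag_mat w) ** diag_mat w = mat 1"
    unfolding matrix_inv_def invertible_def by (rule someI2_ex) simp
  then show ?thesis
    by (metis inv matrix_mul_assoc matrix_mul_lid matrix_mul_rid)
qed

lemma outer_prod_pos_nonzero:
  fixes a b :: "real^'n"
  assumes "\<And>i j. 0 < outer_prod a b $ i $ j"
  shows "a $ i \<noteq> 0" "b $ i \<noteq> 0"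
  using assms[of i i] by (auto simp: outer_prod_def)

text \<open>One implication suffices: the converse is an instance with the reciprocal scaling.
  Positivity is asked only of the products, so \<open>a\<close> and \<open>b\<close> may both be
  negative.\<close>

lemma singular_set_interval_scale:
  fixes A E :: "real^'n^'n"
  assumes pos: "\<And>i j. 0 < outer_prod a b $ i $ j"
    and sing: "singular_set {A - \<delta> *\<^sub>R E .. A + \<delta> *\<^sub>R E}"
  defines "s \<equiv> \<lambda>X. diag_mat a ** X ** diag_mat b"
  shows "singular_set {s A - \<delta> *\<^sub>R s E .. s A + \<delta> *\<^sub>R s E}"
proof -
  obtain X where X: "A - \<delta> *\<^sub>R E \<le> X" "X \<le> A + \<delta> *\<^sub>R E" "det X = 0"
    using sing by (auto simp: singular_set_def invertible_det_nz)
  \<comment> \<open>\<open>s\<close> is the entrywise product with the positive matrix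
    \<open>outer_prod a b\<close>, hence linear and monotone.\<close>
  have nth: "s Y $ i $ j = outer_prod a b $ i $ j * Y $ i $ j" for Y i j
    by (simp add: s_def diag_mat_scale_nth outer_prod_def)
  have mono: "s Y \<le> s Z" if "Y \<le> Z" for Y Z
    using that pos by (simp add: less_eq_vec_def nth less_imp_le mult_left_mono)
  have "s A - \<delta> *\<^sub>R s E = s (A - \<delta> *\<^sub>R E)" "s A + \<delta> *\<^sub>R s E = s (A + \<delta> *\<^sub>R E)"
    by (simp_all add: vec_eq_iff nth algebra_simps)
  with X(1,2) mono have "s X \<in> {s A - \<delta> *\<^sub>R s E .. s A + \<delta> *\<^sub>R s E}"
    by simp
  moreover have "det (s X) = 0"
    using X(3) by (simp add: s_def det_mul)
  ultimately show ?thesis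
    unfolding singular_set_def invertible_det_nz by blast
qed

theorem mainTheorem10:
  fixes A :: "real^'n^'n" and u v :: "real^'n"
  assumes "\<forall>i j. outer_prod u v $ i $ j > 0"
  shows "regularity_radius A (outer_prod u v) =
         regularity_radius_unit (matrix_inv (diag_mat u) ** A ** matrix_inv (diag_mat v))"
proof -
  define a b where "a = (\<chi> i. inverse (u $ i))" and "b = (\<chi> i. inverse (v $ i))"
  define B where "B = diag_mat a ** A ** diag_mat b"
  note nz = outer_prod_pos_nonzero[OF assms[rule_format]]
  have B_eq: "B = matrix_inv (diag_mat u) ** A ** matrix_inv (diag_mat v)"
    using nz by (simp add: B_def a_def b_def matrix_inv_diag_mat)
  have pos': "0 < outer_prod a b $ i $ j" for i j
  proof -
    have "outer_prod a b $ i $ j = inverse (outer_prod u v $ i $ j)"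
      by (simp add: a_def b_def outer_prod_def)
    with assms show ?thesis by simp
  qed
  \<comment> \<open>The first identity moves the radius matrix forward; the other two undo the
    scaling on radius and centre.\<close>
  have scale: "diag_mat a ** outer_prod u v ** diag_mat b = outer_prod ones ones"
      "diag_mat u ** outer_prod ones ones ** diag_mat v = outer_prod u v"
      "diag_mat u ** B ** diag_mat v = A"
    using nz by (simp_all add: vec_eq_iff diag_mat_scale_nth B_def a_def b_def outer_prod_def ones_def field_simps)
  have "singular_set {A - \<delta> *\<^sub>R outer_prod u v .. A + \<delta> *\<^sub>R outer_prod u v} \<longleftrightarrow>
      singular_set {B - \<delta> *\<^sub>R outer_prod ones ones .. B + \<delta> *\<^sub>R outer_prod ones ones}" for \<delta>
    using singular_set_interval_scale[of a b A \<delta> "outer_prod u v", OF pos']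
      singular_set_interval_scale[of u v B \<delta> "outer_prod ones ones", OF assms[rule_format]]
    by (auto simp: scale simp flip: B_def)
  \<comment> \<open>Both radii are \<open>LEAST\<close> of predicates that agree at every \<delta>,
    so the values agree.\<close>
  then show ?thesis
    by (simp add: regularity_radius_unit_def regularity_radius_def flip: B_eq)
qed

end
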